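(* The relaxation (DSMP) is equivalent to the relaxation (SMP).
   Context: Data: points $(\mathsf x^i,y^i)\in\mathbb R^n\times\{-1,1\}$ for $i=1,\dots,m$, a constant $C>0$, a nonnegative integer $B$ (the feature budget), and a real $M>0$ (the big-M parameter). Inequalities between vectors are componentwise; $\mathsf e$ and $\mathsf o$ denote the all-ones and all-zeros vectors; $\mathcal S_+^k$ is the set of real symmetric positive-semidefinite $k\times k$ matrices; $\operatorname{diag}\mathsf X=[X_{jj}]_{j=1}^n$ is the vector of diagonal entries of $\mathsf X$. Two minimization problems are called equivalent if they have the same optimal value. Define $$\Xi=\{(\mathsf w,b,\bm\xi)\in\mathbb R^n\times\mathbb R\times\mathbb R^m:\ y^i(\mathsf w^\top \mathsf x^i+b)\ge 1-\xi_i\ (i=1,\dots,m),\ \bm\xi\ge \mathsf o\},$$ $$\Omega_M=\{(\mathsf w,\mathsf v)\in\mathbb R^{n}\times\mathbb R^n:\ -M\mathsf v\le \mathsf w\le M\mathsf v,\ \mathsf e^\top \mathsf v=B\}.$$ (SMP): minimize $\frac12\operatorname{trace}(\mathsf W)+C\sum_{i=1}^m\xi_i$ over $(\mathsf w,\mathsf W,b,\bm\xi,\mathsf v,\mathsf V)$, with $\mathsf W,\mathsf V$ real symmetric $n\times n$ matrices, subject to $(\mathsf w,b,\bm\xi)\in\Xi$, $(\mathsf w,\mathsf v)\in\Omega_M$, $\operatorname{diag}\mathsf V=\mathsf v$, $$\begin{bmatrix}1&\mathsf w^\top\\ \mathsf w&\mathsf W\end{bmatrix}\in\mathcal S_+^{n+1},\qquad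 \begin{bmatrix}1&\mathsf v^\top\\ \mathsf v&\mathsf V\end{bmatrix}\in\mathcal S_+^{n+1}.$$ (DSMP): minimize $\frac12\sum_{j=1}^n W_{jj}+C\sum_{i=1}^m\xi_i$ over $(\mathsf w,\operatorname{diag}\mathsf W,b,\bm\xi,\mathsf v)$ (where only the $n$ real numbers $W_{11},\dots,W_{nn}$ are variables in place of a matrix $\mathsf W$) subject to $(\mathsf w,b,\bm\xi)\in\Xi$, $(\mathsf w,\mathsf v)\in\Omega_M$, $$\begin{bmatrix}1&w_j\\ w_j&W_{jj}\end{bmatrix}\in\mathcal S_+^2,\qquad \begin{bmatrix}1&v_j\\ v_j&v_j\end{bmatrix}\in\mathcal S_+^2,\qquad j=1,\dots,n.$$ *)

theory Defs
  imports "HOL-Analysis.Analysis"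
begin

text \<open>
  The feature space is \<open>real ^ 'n\<close> and the data points are indexed by \<open>'m\<close>.
  The order on \<open>real ^ 'k\<close> is the componentwise one.
\<close>

definition psd :: "(real ^ 'k ^ 'k) set" where
  "psd = {X. transpose X = X \<and> (\<forall>u. 0 \<le> u \<bullet> (X *v u))}"

definition diag_vec :: "real ^ 'n ^ 'n \<Rightarrow> real ^ 'n" where
  "diag_vec X = (\<chi> j. X $ j $ j)"

text \<open>
  The block matrix with rows \<open>(1, u\<^sup>T)\<close> and \<open>(u, X)\<close>: the \<open>n + 1\<close> rows and columns are
  indexed by \<open>'n option\<close>, where \<open>None\<close> is the leading index.
\<close>

definition bordered :: "real ^ 'n \<Rightarrow> real ^ 'n ^ 'n \<Rightarrow> real ^ ('n option) ^ ('n option)" where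
  "bordered u X = (\<chi> i j. case i of
       None \<Rightarrow> (case j of None \<Rightarrow> 1 | Some l \<Rightarrow> u $ l)
     | Some k \<Rightarrow> (case j of None \<Rightarrow> u $ k | Some l \<Rightarrow> X $ k $ l))"

definition bordered2 :: "real \<Rightarrow> real \<Rightarrow> real ^ 2 ^ 2" where
  "bordered2 a c = vector [vector [1, a], vector [a, c]]"

definition Xi :: "('m::finite \<Rightarrow> real ^ 'n) \<Rightarrow> ('m \<Rightarrow> real) \<Rightarrow> ((real ^ 'n) \<times> real \<times> (real ^ 'm)) set" where
  "Xi x y = {(w, b, \<xi>). (\<forall>i. y i * (w \<bullet> x i + b) \<ge> 1 - \<xi> $ i) \<and> \<xi> \<ge> 0}"

definition Omega :: "real \<Rightarrow> nat \<Rightarrow> ((real ^ 'n) \<times> (real ^ 'n)) set" where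
  "Omega M B = {(w, v). - (M *\<^sub>R v) \<le> w \<and> w \<le> M *\<^sub>R v \<and> (\<Sum>j\<in>UNIV. v $ j) = real B}"

text \<open>
  The optimal value is an infimum in the extended reals, so it is \<open>\<infinity>\<close> for an infeasible problem.
\<close>

definition optimal_value :: "'z set \<Rightarrow> ('z \<Rightarrow> real) \<Rightarrow> ereal" where
  "optimal_value F f = (INF z\<in>F. ereal (f z))"

definition equivalent_problems ::
  "'z set \<times> ('z \<Rightarrow> real) \<Rightarrow> 'z' set \<times> ('z' \<Rightarrow> real) \<Rightarrow> bool" where
  "equivalent_problems P Q \<longleftrightarrow>
     optimal_value (fst P) (snd P) = optimal_value (fst Q) (snd Q)"

type_synonym ('n, 'm) smp_point =
  "(real ^ 'n) \<times> (real ^ 'n ^ 'n) \<times> real \<times> (real ^ 'm) \<times> (real ^ 'n) \<times> (real ^ 'n ^ 'n)"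

definition SMP :: "('m::finite \<Rightarrow> real ^ 'n) \<Rightarrow> ('m \<Rightarrow> real) \<Rightarrow> real \<Rightarrow> nat \<Rightarrow> real \<Rightarrow>
    ('n, 'm) smp_point set \<times> (('n, 'm) smp_point \<Rightarrow> real)" where
  "SMP x y C B M =
     ({(w, W, b, \<xi>, v, V).
         transpose W = W \<and> transpose V = V \<and>
         (w, b, \<xi>) \<in> Xi x y \<and> (w, v) \<in> Omega M B \<and> diag_vec V = v \<and>
         bordered w W \<in> psd \<and> bordered v V \<in> psd},
      \<lambda>(w, W, b, \<xi>, v, V). 1/2 * trace W + C * (\<Sum>i\<in>UNIV. \<xi> $ i))"

text \<open>In (DSMP) the vector \<open>d\<close> collects the real variables \<open>W\<^sub>j\<^sub>j\<close>.\<close>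

type_synonym ('n, 'm) dsmp_point =
  "(real ^ 'n) \<times> (real ^ 'n) \<times> real \<times> (real ^ 'm) \<times> (real ^ 'n)"

definition DSMP :: "('m::finite \<Rightarrow> real ^ 'n) \<Rightarrow> ('m \<Rightarrow> real) \<Rightarrow> real \<Rightarrow> nat \<Rightarrow> real \<Rightarrow>
    ('n, 'm) dsmp_point set \<times> (('n, 'm) dsmp_point \<Rightarrow> real)" where
  "DSMP x y C B M =
     ({(w, d, b, \<xi>, v).
         (w, b, \<xi>) \<in> Xi x y \<and> (w, v) \<in> Omega M B \<and>
         (\<forall>j. bordered2 (w $ j) (d $ j) \<in> psd) \<and>
         (\<forall>j. bordered2 (v $ j) (v $ j) \<in> psd)},
      \<lambda>(w, d, b, \<xi>, v). 1/2 * (\<Sum>j\<in>UNIV. d $ j) + C * (\<Sum>i\<in>UNIV. \<xi> $ i))"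

end

theory Submission imports Defs begin

text \<open>
  The objectives of both problems see a matrix \<open>W\<close> only through its diagonal, and (SMP) sees \<open>V\<close>
  only through its diagonal \<open>v\<close>. So it suffices to know which diagonals \<open>d\<close> are possible for a
  symmetric matrix \<open>X\<close> whose bordering by \<open>u\<close> is positive semidefinite. By the Schur complement
  the bordered matrix is positive semidefinite iff \<open>X - u u\<^sup>T\<close> is; this forces
  \<open>u\<^sub>j\<^sup>2 \<le> X\<^sub>j\<^sub>j\<close>, and conversely, if \<open>u\<^sub>j\<^sup>2 \<le> d\<^sub>j\<close> for all \<open>j\<close>, the matrix
  \<open>u u\<^sup>T + Diag (d\<^sub>j - u\<^sub>j\<^sup>2)\<close> has diagonal \<open>d\<close> and qualifies
  (\<open>exists_psd_bordered_with_diag_iff\<close>). The \<open>2 \<times> 2\<close> constraints of (DSMP) say exactly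
  \<open>u\<^sub>j\<^sup>2 \<le> d\<^sub>j\<close> (\<open>bordered2_psd_iff\<close>). Hence the projection
  \<open>(w, W, b, \<xi>, v, V) \<mapsto> (w, diag W, b, \<xi>, v)\<close> maps the feasible set of (SMP) onto that of (DSMP)
  and preserves the objective, so the infima agree.
\<close>

lemma sum_UNIV_option:
  fixes f :: "'a::finite option \<Rightarrow> real"
  shows "(\<Sum>i\<in>UNIV. f i) = f None + (\<Sum>k\<in>UNIV. f (Some k))"
  by (simp add: UNIV_option_conv sum.reindex)

lemma quadratic_form_bordered:
  fixes u :: "real ^ 'n" and z :: "real ^ ('n option)"
  defines "t \<equiv> \<chi> k. z $ Some k"
  shows "z \<bullet> (bordered u X *v z) = (z $ None)\<^sup>2 + 2 * z $ None * (u \<bullet> t) + t \<bullet> (X *v t)"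
  unfolding t_def bordered_def
  by (simp add: inner_vec_def matrix_vector_mult_def sum_UNIV_option power2_eq_square
      sum.distrib sum_distrib_left algebra_simps)

lemma transpose_bordered: "transpose X = X \<Longrightarrow> transpose (bordered u X) = bordered u X"
  by (auto simp: transpose_def bordered_def vec_eq_iff split: option.split)

lemma bordered2_psd_iff: "bordered2 a c \<in> psd \<longleftrightarrow> a\<^sup>2 \<le> c"
proof -
  have symmetric: "transpose (bordered2 a c) = bordered2 a c"
    by (simp add: bordered2_def transpose_def vec_eq_iff forall_2)
  have form: "z \<bullet> (bordered2 a c *v z) = (z $ 1 + a * z $ 2)\<^sup>2 + (c - a\<^sup>2) * (z $ 2)\<^sup>2" for z
    by (simp add: bordered2_def inner_vec_def matrix_vector_mult_def sum_2 power2_eq_square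
        algebra_simps)
  show ?thesis
  proof
    assume "bordered2 a c \<in> psd"
    then have "0 \<le> vector [-a, 1] \<bullet> (bordered2 a c *v vector [-a, 1])"
      unfolding psd_def by blast
    then show "a\<^sup>2 \<le> c"
      by (simp add: form)
  next
    assume "a\<^sup>2 \<le> c"
    then show "bordered2 a c \<in> psd"
      by (simp add: psd_def symmetric form)
  qed
qed

text \<open>
  The test vector \<open>(-u\<^sub>j, e\<^sub>j)\<close> minimizes the quadratic form over its leading entry when the
  rest is the unit vector \<open>e\<^sub>j\<close>; the minimum is the diagonal entry of the Schur complement.
\<close>

lemma bordered_psd_imp_square_le_diag:
  fixes u :: "real ^ 'n"
  assumes "bordered u X \<in> psd"
  shows "(u $ j)\<^sup>2 \<le> X $ j $ j"
proof -
  define z :: "real ^ ('n option)"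
    where "z = (\<chi> i. case i of None \<Rightarrow> - (u $ j) | Some k \<Rightarrow> axis j 1 $ k)"
  have tail: "(\<chi> k. z $ Some k) = axis j 1"
    by (simp add: z_def vec_eq_iff)
  have "0 \<le> z \<bullet> (bordered u X *v z)"
    using assms unfolding psd_def by blast
  also have "\<dots> = X $ j $ j - (u $ j)\<^sup>2"
    unfolding quadratic_form_bordered tail
    by (simp add: z_def inner_axis inner_axis' matrix_vector_mult_basis column_def power2_eq_square)
  finally show ?thesis by simp
qed

lemma exists_psd_bordered_with_diag_iff:
  fixes u d :: "real ^ 'n"
  shows "(\<exists>X. transpose X = X \<and> diag_vec X = d \<and> bordered u X \<in> psd)
    \<longleftrightarrow> (\<forall>j. (u $ j)\<^sup>2 \<le> d $ j)"
proof
  assume "\<exists>X. transpose X = X \<and> diag_vec X = d \<and> bordered u X \<in> psd"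
  then show "\<forall>j. (u $ j)\<^sup>2 \<le> d $ j"
    by (auto simp: diag_vec_def dest: bordered_psd_imp_square_le_diag)
next
  assume le: "\<forall>j. (u $ j)\<^sup>2 \<le> d $ j"
  define X :: "real ^ 'n ^ 'n"
    where "X = (\<chi> k l. u $ k * u $ l + (if k = l then d $ k - (u $ k)\<^sup>2 else 0))"
  have symmetric: "transpose X = X"
    by (simp add: X_def transpose_def vec_eq_iff)
  have diag: "diag_vec X = d"
    by (simp add: X_def diag_vec_def vec_eq_iff power2_eq_square)
  have X_mult: "X *v t = (u \<bullet> t) *\<^sub>R u + (\<chi> k. (d $ k - (u $ k)\<^sup>2) * t $ k)" for t
    by (simp add: X_def vec_eq_iff matrix_vector_mult_def distrib_right sum.distrib
        if_distrib[where f = "\<lambda>c. c * _"] cong: if_cong)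
      (simp add: inner_vec_def sum_distrib_left ac_simps)
  have form_X: "t \<bullet> (X *v t) = (u \<bullet> t)\<^sup>2 + (\<Sum>k\<in>UNIV. (d $ k - (u $ k)\<^sup>2) * (t $ k)\<^sup>2)" for t
    unfolding X_mult inner_add_right
    by (simp add: inner_commute[of t u] power2_eq_square inner_vec_def[of t "\<chi> k. _ k"]
        mult.left_commute)
  have "0 \<le> z \<bullet> (bordered u X *v z)" for z
  proof -
    define t where "t = (\<chi> k. z $ Some k)"
    \<comment> \<open>Completing the square in the leading entry exposes the diagonal Schur complement.\<close>
    have "z \<bullet> (bordered u X *v z)
        = (z $ None + u \<bullet> t)\<^sup>2 + (\<Sum>k\<in>UNIV. (d $ k - (u $ k)\<^sup>2) * (t $ k)\<^sup>2)"
      unfolding quadratic_form_bordered t_def[symmetric] form_X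
      by (simp add: power2_eq_square algebra_simps)
    also have "\<dots> \<ge> 0"
      using le by (intro add_nonneg_nonneg sum_nonneg mult_nonneg_nonneg) auto
    finally show ?thesis .
  qed
  then have "bordered u X \<in> psd"
    by (simp add: psd_def transpose_bordered symmetric)
  with symmetric diag show "\<exists>X. transpose X = X \<and> diag_vec X = d \<and> bordered u X \<in> psd"
    by blast
qed

lemma equivalent_problems_if_objective_preserving_surjection:
  assumes "p ` G = F" and "\<And>z. z \<in> G \<Longrightarrow> f (p z) = g z"
  shows "equivalent_problems (F, f) (G, g)"
proof -
  have "(\<lambda>z. ereal (f z)) ` F = (\<lambda>z. ereal (g z)) ` G"
    unfolding assms(1)[symmetric] image_image using assms(2) by (intro image_cong) auto
  then show ?thesis
    by (simp add: equivalent_problems_def optimal_value_def)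
qed

theorem corollary3p8:
  fixes x :: "'m::finite \<Rightarrow> real ^ 'n"
    and y :: "'m \<Rightarrow> real"
    and C M :: real
    and B :: nat
  assumes "\<And>i. y i \<in> {-1, 1}"
    and "C > 0"
    and "M > 0"
  shows "equivalent_problems (DSMP x y C B M) (SMP x y C B M)"
proof -
  define p :: "('n, 'm) smp_point \<Rightarrow> ('n, 'm) dsmp_point"
    where "p = (\<lambda>(w, W, b, \<xi>, v, V). (w, diag_vec W, b, \<xi>, v))"
  have "(w, d, b, \<xi>, v) \<in> p ` fst (SMP x y C B M) \<longleftrightarrow> (w, d, b, \<xi>, v) \<in> fst (DSMP x y C B M)"
    for w d b \<xi> v
  proof -
    have "(w, d, b, \<xi>, v) \<in> p ` fst (SMP x y C B M) \<longleftrightarrow>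
        (w, b, \<xi>) \<in> Xi x y \<and> (w, v) \<in> Omega M B \<and>
        (\<exists>W. transpose W = W \<and> diag_vec W = d \<and> bordered w W \<in> psd) \<and>
        (\<exists>V. transpose V = V \<and> diag_vec V = v \<and> bordered v V \<in> psd)"
      by (simp add: p_def SMP_def image_iff split_beta) blast
    also have "\<dots> \<longleftrightarrow> (w, d, b, \<xi>, v) \<in> fst (DSMP x y C B M)"
      by (simp add: exists_psd_bordered_with_diag_iff DSMP_def bordered2_psd_iff)
    finally show ?thesis .
  qed
  then have "p ` fst (SMP x y C B M) = fst (DSMP x y C B M)"
    unfolding set_eq_iff split_paired_All by blast
  moreover have "snd (DSMP x y C B M) (p z) = snd (SMP x y C B M) z" for z
    by (simp add: p_def SMP_def DSMP_def diag_vec_def trace_def split_beta)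
  ultimately have "equivalent_problems
      (fst (DSMP x y C B M), snd (DSMP x y C B M)) (fst (SMP x y C B M), snd (SMP x y C B M))"
    by (intro equivalent_problems_if_objective_preserving_surjection[where p = p])
  then show ?thesis by simp
qed

end
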